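(* There is a competition game over a $3$-sparse network $H$ with two identical firms (both with value function $I_H$) and no PSPE.
   Context: Competition game: $N$ is a finite set of workers, $K$ a finite set of $k\ge 2$ firms, and each firm $i\in K$ has a nondecreasing value function $v_i:2^N\to\mathbb R_+$ with $v_i(\emptyset)=0$. In step 1 all firms simultaneously choose payment policies $\mathbf x_i=(x_{ij})_{j\in N}\in\mathbb R^N$ (payments may be negative). In step 2 each worker chooses a firm or stays idle. An outcome is a pair $(P,\mathbf X)$ where $\mathbf X=(x_{ij})$ and $P=(S_0,(S_i)_{i\in K})$ is a partition of $N$ ($S_0$ = idle workers; parts may be empty). Put $x_{0j}=0$. A worker $j\in S_i$ receives $\hat x_j=x_{ij}$; firm $i$ has profit $r_i(P,\mathbf X)=v_i(S_i)-\sum_{j\in S_i}x_{ij}$. PSPE: let $\mathcal P(\mathbf X)$ be the set of partitions such that every worker $j\in S_i$ ($i\in K\cup\{0\}$) satisfies $x_{ij}=\max_{i'\in K\cup\{0\}}x_{i'j}$. A tie-breaking rule is a map $\mathbf X\mapsto P(\mathbf X)\in\mathcal P(\mathbf X)$. An outcome $(P,\mathbf X)$ is a pure subgame perfect equilibrium (PSPE) if for some tie-breaking rule: (a) $P=P(\mathbf X)$; and (b) for every $i\in K$ and every policy $\mathbf x_i'$, $r_i(P',\mathbf X')\le r_i(P,\mathbf X)$, where $\mathbf X'=(\mathbf x_{-i},\mathbf x_i')$ and $P'=P(\mathbf X')$. Influence network (independent cascade model): a finite directed graph $H=\langle V,E_H\rangle$ with $N\subseteq V$ and a probability $p_{u,u'}\in[0,1]$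 on each edge $(u,u')$. Each edge is independently kept with its probability; when the set $S\subseteq N$ is activated, the active nodes are those reachable by a directed path of kept edges from some node of $S$. The influence $I_H(S)$ is the expected number of active nodes, where only nodes of $V\setminus N$ are counted. $H$ is $t$-sparse (with respect to $N$) if every node $u\in V$ can be reached by a directed path in $H$ from at most $t$ workers of $N$. *)

theory Defs
  imports "HOL-Probability.Probability"
begin

section \<open>Competition games\<close>

definition competition_game :: "'w set \<Rightarrow> 'k set \<Rightarrow> ('k \<Rightarrow> 'w set \<Rightarrow> real) \<Rightarrow> bool" where
  "competition_game N K v \<longleftrightarrow>
     finite N \<and> finite K \<and> 2 \<le> card K \<and>
     (\<forall>i\<in>K. v i {} = 0 \<and> (\<forall>S\<subseteq>N. 0 \<le> v i S) \<and>
        (\<forall>S T. S \<subseteq> T \<longrightarrow> T \<subseteq> N \<longrightarrow> v i S \<le> v i T))"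

text \<open>
  Functions on a finite set are rendered as extensional functions (undefined off their domain),
  so that a tie-breaking rule depends only on the payments \<open>x i j\<close> with \<open>i \<in> K\<close> and \<open>j \<in> N\<close>.
\<close>

definition policies :: "'w set \<Rightarrow> ('w \<Rightarrow> real) set" where
  "policies N = N \<rightarrow>\<^sub>E UNIV"

definition profiles :: "'w set \<Rightarrow> 'k set \<Rightarrow> ('k \<Rightarrow> 'w \<Rightarrow> real) set" where
  "profiles N K = K \<rightarrow>\<^sub>E policies N"

text \<open>\<open>None\<close> is the idle option, written \<open>0\<close> in the usual notation.\<close>

definition choices :: "'k set \<Rightarrow> 'k option set" where
  "choices K = insert None (Some ` K)"

fun payment :: "('k \<Rightarrow> 'w \<Rightarrow> real) \<Rightarrow> 'k option \<Rightarrow> 'w \<Rightarrow> real" where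
  "payment X None j = 0"
| "payment X (Some i) j = X i j"

definition partitions :: "'w set \<Rightarrow> 'k set \<Rightarrow> ('k option \<Rightarrow> 'w set) set" where
  "partitions N K =
     {P \<in> extensional (choices K). (\<Union>c\<in>choices K. P c) = N \<and> disjoint_family_on P (choices K)}"

definition best_partitions ::
  "'w set \<Rightarrow> 'k set \<Rightarrow> ('k \<Rightarrow> 'w \<Rightarrow> real) \<Rightarrow> ('k option \<Rightarrow> 'w set) set" where
  "best_partitions N K X =
     {P \<in> partitions N K. \<forall>c\<in>choices K. \<forall>j\<in>P c.
        payment X c j = Max ((\<lambda>c'. payment X c' j) ` choices K)}"

definition tie_breaking_rule ::
  "'w set \<Rightarrow> 'k set \<Rightarrow> (('k \<Rightarrow> 'w \<Rightarrow> real) \<Rightarrow> 'k option \<Rightarrow> 'w set) \<Rightarrow> bool" where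
  "tie_breaking_rule N K \<tau> \<longleftrightarrow> (\<forall>X\<in>profiles N K. \<tau> X \<in> best_partitions N K X)"

definition profit ::
  "('k \<Rightarrow> 'w set \<Rightarrow> real) \<Rightarrow> ('k option \<Rightarrow> 'w set) \<Rightarrow> ('k \<Rightarrow> 'w \<Rightarrow> real) \<Rightarrow> 'k \<Rightarrow> real" where
  "profit v P X i = v i (P (Some i)) - (\<Sum>j\<in>P (Some i). X i j)"

definition pspe ::
  "'w set \<Rightarrow> 'k set \<Rightarrow> ('k \<Rightarrow> 'w set \<Rightarrow> real) \<Rightarrow>
   ('k option \<Rightarrow> 'w set) \<Rightarrow> ('k \<Rightarrow> 'w \<Rightarrow> real) \<Rightarrow> bool" where
  "pspe N K v P X \<longleftrightarrow>
     P \<in> partitions N K \<and> X \<in> profiles N K \<and>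
     (\<exists>\<tau>. tie_breaking_rule N K \<tau> \<and> P = \<tau> X \<and>
        (\<forall>i\<in>K. \<forall>x'\<in>policies N.
           profit v (\<tau> (X(i := x'))) (X(i := x')) i \<le> profit v P X i))"

section \<open>Influence networks\<close>

definition influence_network ::
  "'v set \<Rightarrow> 'v set \<Rightarrow> ('v \<times> 'v) set \<Rightarrow> ('v \<times> 'v \<Rightarrow> real) \<Rightarrow> bool" where
  "influence_network V N E p \<longleftrightarrow>
     finite V \<and> N \<subseteq> V \<and> E \<subseteq> V \<times> V \<and> (\<forall>e\<in>E. 0 \<le> p e \<and> p e \<le> 1)"

definition active_nodes :: "('v \<times> 'v) set \<Rightarrow> 'v set \<Rightarrow> 'v set" where
  "active_nodes F S = F\<^sup>* `` S"

text \<open>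
  A sample of the product distribution is the indicator function of the set of kept edges.
\<close>

definition influence ::
  "'v set \<Rightarrow> 'v set \<Rightarrow> ('v \<times> 'v) set \<Rightarrow> ('v \<times> 'v \<Rightarrow> real) \<Rightarrow> 'v set \<Rightarrow> real" where
  "influence V N E p S =
     measure_pmf.expectation (Pi_pmf E False (\<lambda>e. bernoulli_pmf (p e)))
       (\<lambda>kept. real (card (active_nodes {e \<in> E. kept e} S \<inter> (V - N))))"

text \<open>Paths of length zero count, so every worker reaches itself.\<close>

definition t_sparse :: "nat \<Rightarrow> 'v set \<Rightarrow> 'v set \<Rightarrow> ('v \<times> 'v) set \<Rightarrow> bool" where
  "t_sparse t V N E \<longleftrightarrow> (\<forall>u\<in>V. card {j \<in> N. (j, u) \<in> E\<^sup>*} \<le> t)"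

end

theory Submission imports Defs begin

text \<open>
  Let \<open>q j\<close> be the largest payment available to worker \<open>j\<close>. Paying slightly more than \<open>q\<close> exactly
  on \<open>T\<close> hires \<open>T\<close>, so in a PSPE every firm earns at least \<open>v T - q T\<close>: the prices \<open>q\<close> support a
  Walrasian equilibrium. It is therefore enough to find a network whose configuration LP has an
  integrality gap. The workers are the six edges of \<open>K\<^sub>4\<close>, and there are seven target nodes: one for
  each of the three perfect matchings and one for each of the four stars, reached with certainty
  from the edges it contains. Every star reaches all seven targets and every worker lies in two
  stars, so weight \<open>1/2\<close> on each star gives fractional welfare \<open>4 * 7 / 2 = 14\<close>. A partition of
  welfare \<open>14\<close> would need two disjoint sets, each meeting all matchings and all stars. Two disjoint
  sets meeting all matchings contain exactly one edge of each, so one of them is a star and the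
  other is the opposite triangle, which misses this star.
\<close>

section \<open>Prices induced by an equilibrium\<close>

definition best_payment :: "'k set \<Rightarrow> ('k \<Rightarrow> 'w \<Rightarrow> real) \<Rightarrow> 'w \<Rightarrow> real" where
  "best_payment K X j = Max ((\<lambda>c. payment X c j) ` choices K)"

lemma finite_choices: "finite K \<Longrightarrow> finite (choices K)"
  by (simp add: choices_def)

lemma payment_le_best:
  assumes "finite K" "c \<in> choices K"
  shows "payment X c j \<le> best_payment K X j"
  unfolding best_payment_def by (intro Max_ge) (use assms finite_choices in auto)

lemma best_payment_nonneg: "finite K \<Longrightarrow> 0 \<le> best_payment K X j"
  using payment_le_best[of K None X j] by (simp add: choices_def)

lemma best_partition_payment:
  assumes "P \<in> best_partitions N K X" "c \<in> choices K" "j \<in> P c"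
  shows "payment X c j = best_payment K X j"
  using assms by (auto simp: best_partitions_def best_payment_def)

lemma partition_cover:
  assumes "P \<in> partitions N K" "j \<in> N"
  obtains c where "c \<in> choices K" "j \<in> P c"
  using assms by (auto simp: partitions_def)

text \<open>Paying \<open>-1\<close> outside \<open>T\<close> drives these workers away, since being idle pays \<open>0\<close>.\<close>

lemma overbidding_hires:
  fixes \<epsilon> :: real
  assumes fin: "finite K" and i: "i \<in> K" and T: "T \<subseteq> N" and \<epsilon>: "0 < \<epsilon>"
    and y: "\<And>j. j \<in> N \<Longrightarrow> y j = (if j \<in> T then best_payment K X j + \<epsilon> else -1)"
    and P: "P \<in> best_partitions N K (X(i := y))"
  shows "P (Some i) = T"
proof
  have part: "P \<in> partitions N K" using P by (simp add: best_partitions_def)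
  have ic: "Some i \<in> choices K" using i by (simp add: choices_def)
  show "P (Some i) \<subseteq> T"
  proof
    fix j assume j: "j \<in> P (Some i)"
    then have "j \<in> N" using part ic by (auto simp: partitions_def)
    moreover have "0 \<le> y j"
      using best_partition_payment[OF P ic j] best_payment_nonneg[OF fin] by simp
    ultimately show "j \<in> T" using y[of j] by (simp split: if_splits)
  qed
  show "T \<subseteq> P (Some i)"
  proof
    fix j assume j: "j \<in> T"
    then have jN: "j \<in> N" using T by auto
    obtain c where c: "c \<in> choices K" "j \<in> P c" using partition_cover[OF part jN] .
    have "y j \<le> payment (X(i := y)) c j"
      using best_partition_payment[OF P c] payment_le_best[OF fin ic, of "X(i := y)" j] by simp
    then have "best_payment K X j < payment (X(i := y)) c j" using y[OF jN] j \<epsilon> by simp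
    \<comment> \<open>The deviation leaves every option other than \<open>Some i\<close> unchanged,
      so each of them pays at most the old maximum.\<close>
    then have "c = Some i"
      using payment_le_best[OF fin c(1), of X j] by (cases c) (auto split: if_splits)
    then show "j \<in> P (Some i)" using c by simp
  qed
qed

lemma pspe_best_partition:
  "pspe N K v P X \<Longrightarrow> P \<in> best_partitions N K X"
  by (auto simp: pspe_def tie_breaking_rule_def)

text \<open>By \<open>overbidding_hires\<close>, firm \<open>i\<close> can secure \<open>T\<close>
  at a cost arbitrarily close to the prices, whatever the tie-breaking rule. The prices also take
  the current offers of \<open>i\<close> itself into account, so the same prices serve all
  firms.\<close>

lemma pspe_profit_ge:
  assumes pspe: "pspe N K v P X" and fin: "finite N" "finite K" and i: "i \<in> K" and T: "T \<subseteq> N"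
  shows "v i T - (\<Sum>j\<in>T. best_payment K X j) \<le> profit v P X i"
proof (rule field_le_epsilon)
  fix e :: real assume e: "0 < e"
  \<comment> \<open>The slack \<open>e\<close> is shared among the workers of \<open>T\<close>; the
    \<open>+ 1\<close> keeps \<epsilon> positive when \<open>T\<close> is empty.\<close>
  define \<epsilon> where "\<epsilon> = e / (card T + 1)"
  have \<epsilon>: "0 < \<epsilon>" "card T * \<epsilon> \<le> e" using e by (auto simp: \<epsilon>_def field_simps)
  define y where
    "y = restrict (\<lambda>j. if j \<in> T then best_payment K X j + \<epsilon> else -1) N"
  obtain \<tau> where \<tau>: "tie_breaking_rule N K \<tau>"
    and opt: "\<And>x'. x' \<in> policies N \<Longrightarrow>
      profit v (\<tau> (X(i := x'))) (X(i := x')) i \<le> profit v P X i"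
    using pspe i by (auto simp: pspe_def)
  have ypol: "y \<in> policies N" by (simp add: y_def policies_def)
  have "X \<in> profiles N K" using pspe by (simp add: pspe_def)
  then have "X(i := y) \<in> profiles N K"
    using ypol i unfolding profiles_def by (auto simp: PiE_def extensional_def)
  then have "\<tau> (X(i := y)) \<in> best_partitions N K (X(i := y))"
    using \<tau> by (simp add: tie_breaking_rule_def)
  then have hired: "\<tau> (X(i := y)) (Some i) = T"
    by (rule overbidding_hires[OF fin(2) i T \<epsilon>(1), rotated]) (simp add: y_def)
  have "(\<Sum>j\<in>T. y j) = (\<Sum>j\<in>T. best_payment K X j + \<epsilon>)"
    using T by (intro sum.cong) (auto simp: y_def)
  then have "(\<Sum>j\<in>T. y j) \<le> (\<Sum>j\<in>T. best_payment K X j) + e"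
    using \<epsilon>(2) by (simp add: sum.distrib)
  moreover have "v i T - (\<Sum>j\<in>T. y j) \<le> profit v P X i"
    using opt[OF ypol] by (simp add: profit_def hired)
  ultimately show "v i T - (\<Sum>j\<in>T. best_payment K X j) \<le> profit v P X i + e" by simp
qed

lemma best_partition_profit:
  assumes "P \<in> best_partitions N K X" "i \<in> K"
  shows "profit v P X i = v i (P (Some i)) - (\<Sum>j\<in>P (Some i). best_payment K X j)"
proof -
  have "(\<Sum>j\<in>P (Some i). X i j) = (\<Sum>j\<in>P (Some i). best_payment K X j)"
    using best_partition_payment[OF assms(1), of "Some i"] assms(2)
    by (intro sum.cong) (auto simp: choices_def)
  then show ?thesis by (simp add: profit_def)
qed

text \<open>Market clearing: idleness pays 0 and is chosen only when it is a best option, so idle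
  workers have price 0 and drop out of the sum.\<close>

lemma best_partition_sum_payments:
  assumes P: "P \<in> best_partitions N K X" and fin: "finite N" "finite K"
  shows "(\<Sum>i\<in>K. \<Sum>j\<in>P (Some i). best_payment K X j) = (\<Sum>j\<in>N. best_payment K X j)"
proof -
  have part: "(\<Union>c\<in>choices K. P c) = N" "disjoint_family_on P (choices K)"
    using P by (auto simp: best_partitions_def partitions_def)
  have finP: "finite (P c)" if "c \<in> choices K" for c
    using part(1) fin(1) that by (metis UN_upper finite_subset)
  have idle: "(\<Sum>j\<in>P None. best_payment K X j) = 0"
    using best_partition_payment[OF P, of None] by (intro sum.neutral) (auto simp: choices_def)
  have "(\<Sum>j\<in>N. best_payment K X j) = (\<Sum>c\<in>choices K. \<Sum>j\<in>P c. best_payment K X j)"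
    unfolding part(1)[symmetric]
    by (intro sum.UNION_disjoint)
      (use part(2) fin finP in \<open>auto simp: finite_choices disjoint_family_on_def\<close>)
  also have "\<dots> = (\<Sum>i\<in>K. \<Sum>j\<in>P (Some i). best_payment K X j)"
    using fin(2) idle by (simp add: choices_def sum.reindex)
  finally show ?thesis ..
qed

section \<open>Deterministic influence in bipartite networks\<close>

lemma bipartite_rtrancl:
  assumes "E \<subseteq> N \<times> U" "N \<inter> U = {}"
  shows "E\<^sup>* = Id \<union> E"
proof -
  \<comment> \<open>Heads of edges lie in \<open>U\<close>, hence outside \<open>N\<close>, so no
    path has two edges.\<close>
  have "(a, b) \<in> Id \<union> E" if "(a, b) \<in> E\<^sup>*" for a b
    using that by (induction rule: rtrancl_induct) (use assms in auto)
  then show ?thesis by auto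
qed

text \<open>With all probabilities 1 the sample is a point mass at the full edge set. The empty
  paths only reach workers, which are not counted.\<close>

lemma influence_bipartite:
  assumes fin: "finite V" and E: "E \<subseteq> N \<times> (V - N)" and NV: "N \<subseteq> V" and S: "S \<subseteq> N"
  shows "influence V N E (\<lambda>_. 1) S = card (E `` S)"
proof -
  have finE: "finite E"
    using E fin NV by (meson finite_Diff finite_SigmaI finite_subset)
  have "bernoulli_pmf 1 = return_pmf True"
  proof (rule pmf_eqI)
    show "pmf (bernoulli_pmf 1) b = pmf (return_pmf True) b" for b
      by (cases b) simp_all
  qed
  then have "influence V N E (\<lambda>_. 1) S =
      card (active_nodes {e \<in> E. e \<in> E} S \<inter> (V - N))"
    by (simp add: influence_def Pi_pmf_return_pmf[OF finE])
  also have "active_nodes {e \<in> E. e \<in> E} S \<inter> (V - N) = E `` S"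
    using S E by (auto simp: active_nodes_def bipartite_rtrancl[OF E])
  finally show ?thesis .
qed

lemma competition_game_bipartite:
  assumes "finite V" "E \<subseteq> N \<times> (V - N)" "N \<subseteq> V" "finite K" "2 \<le> card K"
  shows "competition_game N K (\<lambda>_. influence V N E (\<lambda>_. 1))"
proof -
  have inf: "influence V N E (\<lambda>_. 1) S = card (E `` S)" if "S \<subseteq> N" for S
    using influence_bipartite[OF assms(1-3) that] .
  have "finite (E `` T)" for T
    by (rule finite_subset[of _ V]) (use assms in auto)
  then have "card (E `` S) \<le> card (E `` T)" if "S \<subseteq> T" for S T
    using that by (intro card_mono Image_mono) auto
  moreover have "finite N" using assms finite_subset by blast
  ultimately show ?thesis
    using assms(4,5) inf by (auto simp: competition_game_def)
qed

section \<open>The network built from K4\<close>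

text \<open>
  The edges of \<open>K\<^sub>4\<close> are numbered \<open>0, \<dots>, 5\<close> so that the perfect matchings are \<open>{2m, 2m + 1}\<close>.
\<close>

definition members :: "nat \<Rightarrow> nat set" where
  "members u =
     (if u = 6 then {0, 1} else if u = 7 then {2, 3} else if u = 8 then {4, 5}
      else if u = 9 then {0, 2, 4} else if u = 10 then {0, 3, 5}
      else if u = 11 then {1, 2, 5} else if u = 12 then {1, 3, 4} else {})"

definition K4_edges :: "(nat \<times> nat) set" where
  "K4_edges = {(j, u). j \<in> members u}"

lemma targets_eq: "{..<13} - {..<6} = {6, 7, 8, 9, 10, 11, 12 :: nat}"
  by auto

lemma members_subset: "members u \<subseteq> {..<6}"
  by (simp add: members_def)

lemma members_eq_empty: "u \<notin> {6, 7, 8, 9, 10, 11, 12} \<Longrightarrow> members u = {}"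
  by (simp add: members_def)

lemma K4_edges_subset: "K4_edges \<subseteq> {..<6} \<times> ({..<13} - {..<6})"
  unfolding targets_eq using members_subset members_eq_empty by (fastforce simp: K4_edges_def)

lemma card_members_le: "card (members u) \<le> 3"
  by (simp add: members_def card_insert_if)

lemma t_sparse_K4: "t_sparse 3 {..<13} {..<6} K4_edges"
  unfolding t_sparse_def
proof
  fix u :: nat
  have "K4_edges\<^sup>* = Id \<union> K4_edges"
    by (rule bipartite_rtrancl[OF K4_edges_subset]) auto
  then have eq: "{j \<in> {..<6}. (j, u) \<in> K4_edges\<^sup>*} = (if u < 6 then {u} else members u)"
    using members_subset[of u] members_eq_empty[of u] by (auto simp: K4_edges_def)
  show "card {j \<in> {..<6}. (j, u) \<in> K4_edges\<^sup>*} \<le> 3"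
    unfolding eq using card_members_le[of u] by simp
qed

text \<open>A star meets each perfect matching in the edge at its centre, and any other star in the
  edge joining the two centres.\<close>

lemma card_image_star: "u \<in> {9, 10, 11, 12} \<Longrightarrow> card (K4_edges `` members u) = 7"
proof -
  assume u: "u \<in> {9, 10, 11, 12}"
  have "{6, 7, 8, 9, 10, 11, 12} \<subseteq> K4_edges `` members u"
    using u by (auto simp: K4_edges_def members_def)
  then have "K4_edges `` members u = {6, 7, 8, 9, 10, 11, 12}"
    using K4_edges_subset targets_eq by blast
  then show ?thesis by simp
qed

lemma card_image_le: "card (K4_edges `` S) \<le> 7"
proof -
  have "card (K4_edges `` S) \<le> card {6, 7, 8, 9, 10, 11, 12 :: nat}"
    using K4_edges_subset targets_eq by (intro card_mono) auto
  then show ?thesis by simp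
qed

lemma card_image_eq_7D:
  assumes "card (K4_edges `` S) = 7" "u \<in> {6, 7, 8, 9, 10, 11, 12}"
  shows "S \<inter> members u \<noteq> {}"
proof -
  have "K4_edges `` S = {6, 7, 8, 9, 10, 11, 12}"
    using K4_edges_subset targets_eq assms(1) by (intro card_subset_eq) auto
  then have "u \<in> K4_edges `` S" using assms(2) by simp
  then show ?thesis by (auto simp: K4_edges_def)
qed

lemma disjoint_welfare_less:
  assumes "S \<inter> T = {}"
  shows "card (K4_edges `` S) + card (K4_edges `` T) < 14"
proof (rule ccontr)
  assume "\<not> ?thesis"
  then have "card (K4_edges `` S) = 7" "card (K4_edges `` T) = 7"
    using card_image_le[of S] card_image_le[of T] by auto
  note meet = card_image_eq_7D[OF this(1)] card_image_eq_7D[OF this(2)]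
  have "j \<notin> S \<or> j \<notin> T" for j using assms by auto
  \<comment> \<open>Only the membership of the six edges in \<open>S\<close> and in \<open>T\<close>
    matters, so the contradiction is purely propositional.\<close>
  from this[of 0] this[of 1] this[of 2] this[of 3] this[of 4] this[of 5]
    meet[of 6] meet[of 7] meet[of 8] meet[of 9] meet[of 10] meet[of 11] meet[of 12]
  show False
    by (simp add: members_def) argo
qed

text \<open>Double counting: an edge has two endpoints, so it lies in exactly two stars.\<close>

lemma sum_stars:
  fixes f :: "nat \<Rightarrow> real"
  shows "(\<Sum>u\<in>{9, 10, 11, 12}. \<Sum>j\<in>members u. f j) = 2 * (\<Sum>j<6. f j)"
  by (simp add: members_def eval_nat_numeral)

lemma no_pspe_K4:
  assumes v: "\<And>S. S \<subseteq> {..<6} \<Longrightarrow> v S = real (card (K4_edges `` S))"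
  shows "\<not> pspe {..<6} {1, 2 :: nat} (\<lambda>_. v) P X"
proof
  let ?K = "{1, 2 :: nat}"
  let ?q = "best_payment ?K X"
  let ?r = "profit (\<lambda>_. v) P X"
  assume pspe: "pspe {..<6} ?K (\<lambda>_. v) P X"
  note P = pspe_best_partition[OF pspe]
  have part: "P \<in> partitions {..<6} ?K" using P by (simp add: best_partitions_def)
  \<comment> \<open>Sum of the bounds from \<open>pspe_profit_ge\<close> over the four stars, each
    worth 7.\<close>
  have "4 * ?r i \<ge> 28 - 2 * (\<Sum>j<6. ?q j)" if "i \<in> ?K" for i
  proof -
    have "7 - (\<Sum>j\<in>members u. ?q j) \<le> ?r i" if u: "u \<in> {9, 10, 11, 12}" for u
      using pspe_profit_ge[OF pspe _ _ \<open>i \<in> ?K\<close>, of "members u"] members_subset[of u] v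
        card_image_star[OF u] by simp
    then have "(\<Sum>u\<in>{9, 10, 11, 12::nat}. 7 - (\<Sum>j\<in>members u. ?q j)) \<le>
        (\<Sum>u\<in>{9, 10, 11, 12::nat}. ?r i)"
      by (rule sum_mono)
    then show ?thesis using sum_stars[of ?q] by (simp add: sum_subtractf)
  qed
  from this[of 1] this[of 2] have "?r 1 + ?r 2 \<ge> 14 - (\<Sum>j<6. ?q j)" by simp
  \<comment> \<open>By market clearing the prices cancel, which bounds the welfare itself from
    below.\<close>
  moreover have "?r 1 + ?r 2 = v (P (Some 1)) + v (P (Some 2)) - (\<Sum>j<6. ?q j)"
    using best_partition_profit[OF P, of 1 "\<lambda>_. v"] best_partition_profit[OF P, of 2 "\<lambda>_. v"]
      best_partition_sum_payments[OF P] by simp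
  ultimately have "v (P (Some 1)) + v (P (Some 2)) \<ge> 14" by simp
  moreover have "P (Some 1) \<subseteq> {..<6}" "P (Some 2) \<subseteq> {..<6}" "P (Some 1) \<inter> P (Some 2) = {}"
    using part by (auto simp: partitions_def choices_def disjoint_family_on_def)
  ultimately show False
    using disjoint_welfare_less[of "P (Some 1)" "P (Some 2)"] v by fastforce
qed

theorem proposition5p7:
  "\<exists>(V :: nat set) N E p.
     influence_network V N E p \<and>
     t_sparse 3 V N E \<and>
     competition_game N {1, 2 :: nat} (\<lambda>_. influence V N E p) \<and>
     \<not> (\<exists>P X. pspe N {1, 2 :: nat} (\<lambda>_. influence V N E p) P X)"
proof (intro exI conjI)
  let ?V = "{..<13 :: nat}" and ?N = "{..<6 :: nat}"
  show "influence_network ?V ?N K4_edges (\<lambda>_. 1)"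
    using K4_edges_subset by (auto simp: influence_network_def)
  show "t_sparse 3 ?V ?N K4_edges" by (rule t_sparse_K4)
  show "competition_game ?N {1, 2 :: nat} (\<lambda>_. influence ?V ?N K4_edges (\<lambda>_. 1))"
    by (rule competition_game_bipartite) (use K4_edges_subset in auto)
  show "\<not> (\<exists>P X. pspe ?N {1, 2 :: nat} (\<lambda>_. influence ?V ?N K4_edges (\<lambda>_. 1)) P X)"
    using no_pspe_K4 influence_bipartite[OF _ K4_edges_subset] by auto
qed

end
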